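(* Let $\mathcal{M}$ be a 4-orbit $(n-1)$-maniplex. Then one of the following holds: (1) $\mathcal{M}$ is fully-transitive; (2) there exists $i\in\{0,\dots,n-1\}$ such that $\mathcal{M}$ is $j$-face-transitive for all $j\neq i$; (3) there exist $i,k\in\{0,\dots,n-1\}$ with $i\neq k$ such that $\mathcal{M}$ is $j$-face-transitive for all $j\neq i,k$; (4) there exists $i\in\{0,\dots,n-1\}$ such that $\mathcal{M}$ is $j$-face-transitive for all $j\notin\{i-1,i,i+1\}$.
   Context: An $(n-1)$-maniplex is given by a connected simple graph (flag graph), whose vertices are called flags, with a proper edge-colouring by colours $\{0,\dots,n-1\}$, each colour class a perfect matching, such that for colours $i,j$ with $|i-j|\ge2$ each component of the subgraph spanned by colours $i,j$ is a 4-cycle. Automorphisms are colour-preserving graph automorphisms; 4-orbit means exactly 4 orbits on flags. A $j$-face is a connected component of the flag graph with the $j$-edges removed; $\mathcal{M}$ is $j$-face-transitive if $\mathrm{Aut}(\mathcal{M})$ is transitive on $j$-faces, and fully-transitive if it is $j$-face-transitive for all $j\in\{0,\dots,n-1\}$. *)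

theory Defs
  imports "Graph_Theory.Digraph_Component"
begin

text \<open>
  A simple graph, possibly infinite, is a \<open>pair_bidirected_digraph\<close>: each edge \<open>{u, v}\<close> is
  represented by the two arcs \<open>(u, v)\<close> and \<open>(v, u)\<close>. A colouring assigns a number to the
  unordered pair \<open>{u, v}\<close>; its values on sets that are not edges are irrelevant.
\<close>

definition colour_subgraph ::
  "'a pair_pre_digraph \<Rightarrow> ('a set \<Rightarrow> nat) \<Rightarrow> nat set \<Rightarrow> 'a pair_pre_digraph" where
  "colour_subgraph G col I =
     \<lparr>pverts = pverts G, parcs = {(u, v). (u, v) \<in> parcs G \<and> col {u, v} \<in> I}\<rparr>"

text \<open>For symmetric digraphs, the strongly connected components are the connected components.\<close>

definition components :: "'a pair_pre_digraph \<Rightarrow> ('a, 'a \<times> 'a) pre_digraph set" where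
  "components G = pre_digraph.sccs (with_proj G)"

definition is_four_cycle :: "('a, 'a \<times> 'a) pre_digraph \<Rightarrow> bool" where
  "is_four_cycle C \<longleftrightarrow>
     (\<exists>a b c d. distinct [a, b, c, d] \<and> verts C = {a, b, c, d} \<and>
        arcs C = {(a, b), (b, a), (b, c), (c, b), (c, d), (d, c), (d, a), (a, d)})"

text \<open>\<open>maniplex n G col\<close> is an \<open>(n-1)\<close>-maniplex; note that \<open>connected\<close> excludes the empty graph.\<close>

locale maniplex = pair_bidirected_digraph G
  for n :: nat and G :: "'a pair_pre_digraph" and col :: "'a set \<Rightarrow> nat" +
  assumes connected_flag_graph: "Digraph_Component.connected (with_proj G)"
    and colour_range: "(u, v) \<in> parcs G \<Longrightarrow> col {u, v} < n"
    and proper_colouring: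
      "\<lbrakk>(u, v) \<in> parcs G; (u, w) \<in> parcs G; v \<noteq> w\<rbrakk> \<Longrightarrow> col {u, v} \<noteq> col {u, w}"
    and perfect_matching:
      "\<lbrakk>i < n; u \<in> pverts G\<rbrakk> \<Longrightarrow> \<exists>!v. (u, v) \<in> parcs G \<and> col {u, v} = i"
    and four_cycles:
      "\<lbrakk>i < n; j < n; \<bar>int i - int j\<bar> \<ge> 2; C \<in> components (colour_subgraph G col {i, j})\<rbrakk>
        \<Longrightarrow> is_four_cycle C"

text \<open>Automorphisms are only constrained on the flags; their values elsewhere play no role.\<close>

definition automorphisms :: "'a pair_pre_digraph \<Rightarrow> ('a set \<Rightarrow> nat) \<Rightarrow> ('a \<Rightarrow> 'a) set" where
  "automorphisms G col =
     {\<phi>. bij_betw \<phi> (pverts G) (pverts G) \<and>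
         (\<forall>u\<in>pverts G. \<forall>v\<in>pverts G. (\<phi> u, \<phi> v) \<in> parcs G \<longleftrightarrow> (u, v) \<in> parcs G) \<and>
         (\<forall>u v. (u, v) \<in> parcs G \<longrightarrow> col {\<phi> u, \<phi> v} = col {u, v})}"

definition flag_orbits :: "'a pair_pre_digraph \<Rightarrow> ('a set \<Rightarrow> nat) \<Rightarrow> 'a set set" where
  "flag_orbits G col = (\<lambda>u. {\<phi> u | \<phi>. \<phi> \<in> automorphisms G col}) ` pverts G"

definition faces ::
  "'a pair_pre_digraph \<Rightarrow> ('a set \<Rightarrow> nat) \<Rightarrow> nat \<Rightarrow> ('a, 'a \<times> 'a) pre_digraph set" where
  "faces G col j = components (colour_subgraph G col (- {j}))"

definition graph_image ::
  "('a \<Rightarrow> 'a) \<Rightarrow> ('a, 'a \<times> 'a) pre_digraph \<Rightarrow> ('a, 'a \<times> 'a) pre_digraph" where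
  "graph_image \<phi> F = with_proj \<lparr>pverts = \<phi> ` verts F, parcs = map_prod \<phi> \<phi> ` arcs F\<rparr>"

definition face_transitive :: "'a pair_pre_digraph \<Rightarrow> ('a set \<Rightarrow> nat) \<Rightarrow> nat \<Rightarrow> bool" where
  "face_transitive G col j \<longleftrightarrow>
     (\<forall>F\<in>faces G col j. \<forall>F'\<in>faces G col j. \<exists>\<phi>\<in>automorphisms G col. graph_image \<phi> F = F')"

definition fully_transitive :: "nat \<Rightarrow> 'a pair_pre_digraph \<Rightarrow> ('a set \<Rightarrow> nat) \<Rightarrow> bool" where
  "fully_transitive n G col \<longleftrightarrow> (\<forall>j<n. face_transitive G col j)"

end

theory Submission
  imports Defs
begin

text \<open>
  Write \<open>r\<^sub>i\<close> for the map sending a flag to its \<open>i\<close>-neighbour. If \<open>j\<close>-face-transitivity fails,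
  the flags having an image in a fixed \<open>j\<close>-face form a proper nonempty set \<open>A\<^sub>j\<close> that is a union of
  orbits and closed under \<open>r\<^sub>i\<close> for all \<open>i \<noteq> j\<close>; by connectivity, \<open>r\<^sub>j\<close> moves some flag
  across the boundary of \<open>A\<^sub>j\<close>.

  Let \<open>a, b, c\<close> be three such colours. If \<open>r\<^sub>a\<close> and \<open>r\<^sub>b\<close> commute and both move \<open>q\<close> across their
  boundaries, then \<open>q, r\<^sub>a q, r\<^sub>b q, r\<^sub>a r\<^sub>b q\<close> represent all four orbits, although \<open>A\<^sub>c\<close> does not
  separate them, which is impossible. Now let \<open>r\<^sub>x\<close> commute with \<open>r\<^sub>y\<close> and \<open>r\<^sub>z\<close>, and let \<open>p, u, v\<close> be
  moved across by \<open>r\<^sub>x, r\<^sub>y, r\<^sub>z\<close> respectively. Then \<open>p, r\<^sub>x p, u, r\<^sub>y u\<close> represent all four orbits, so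
  \<open>v\<close> and \<open>r\<^sub>z v\<close> lie in the orbits of \<open>u\<close> and \<open>r\<^sub>y u\<close>, one in each. But \<open>A\<^sub>y\<close> separates the latter
  and not the former. Hence no failing colour commutes with two others, which leaves at most
  two failing colours or three consecutive ones.
\<close>

section \<open>Connected components\<close>

lemma (in pair_sym_digraph) components_conv:
  "components G = (\<lambda>u. with_proj G \<restriction> {v. u \<rightarrow>\<^sup>*\<^bsub>with_proj G\<^esub> v}) ` pverts G"
proof -
  have "scc_of u = {v. u \<rightarrow>\<^sup>*\<^bsub>with_proj G\<^esub> v}" for u
    by (auto simp: scc_of_def intro: symmetric_reachable')
  then show ?thesis
    unfolding components_def sccs_conv_sccs_verts sccs_verts_conv_scc_of by (simp add: image_image)
qed

lemma colour_subgraph_simps [simp]: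
  "pverts (colour_subgraph G col I) = pverts G"
  "(u, v) \<in> parcs (colour_subgraph G col I) \<longleftrightarrow> (u, v) \<in> parcs G \<and> col {u, v} \<in> I"
  by (auto simp: colour_subgraph_def)

text \<open>Both \<open>x\<close> and \<open>y\<close> are the vertex opposite to \<open>u\<close>.
  In this form the 4-cycle condition yields commuting neighbour maps.\<close>

lemma is_four_cycle_common_neighbour:
  assumes C: "is_four_cycle C"
    and "(u, v) \<in> arcs C" "(u, w) \<in> arcs C" "v \<noteq> w"
    and "(v, x) \<in> arcs C" "x \<noteq> u" "(w, y) \<in> arcs C" "y \<noteq> u"
  shows "x = y"
proof -
  obtain a b c d where "distinct [a, b, c, d]"
    and "arcs C = {(a, b), (b, a), (b, c), (c, b), (c, d), (d, c), (d, a), (a, d)}"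
    using C by (auto simp: is_four_cycle_def)
  with assms(2-) show ?thesis
    by auto
qed

section \<open>Automorphisms and flag orbits\<close>

definition flag_orbit :: "'a pair_pre_digraph \<Rightarrow> ('a set \<Rightarrow> nat) \<Rightarrow> 'a \<Rightarrow> 'a set" where
  "flag_orbit G col u = {\<phi> u | \<phi>. \<phi> \<in> automorphisms G col}"

lemma flag_orbits_conv: "flag_orbits G col = flag_orbit G col ` pverts G"
  by (simp add: flag_orbits_def flag_orbit_def)

lemma automorphisms_id: "id \<in> automorphisms G col"
  by (simp add: automorphisms_def)

context pair_wf_digraph
begin

lemma automorphisms_comp:
  assumes "\<phi> \<in> automorphisms G col" "\<psi> \<in> automorphisms G col"
  shows "\<psi> \<circ> \<phi> \<in> automorphisms G col"
proof -
  have "\<phi> u \<in> pverts G" if "u \<in> pverts G" for u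
    using assms(1) that by (auto simp: automorphisms_def bij_betw_def)
  then show ?thesis
    using assms in_arcsD1 in_arcsD2 unfolding automorphisms_def by (auto simp: bij_betw_trans)
qed

text \<open>The inverse is taken relative to \<open>pverts G\<close>, since an automorphism is
  arbitrary off the flags and need not be injective there.\<close>

lemma automorphisms_inv_into:
  assumes \<phi>: "\<phi> \<in> automorphisms G col"
  shows "inv_into (pverts G) \<phi> \<in> automorphisms G col"
proof -
  let ?\<psi> = "inv_into (pverts G) \<phi>"
  have bij: "bij_betw \<phi> (pverts G) (pverts G)"
    and arcs: "\<And>u v. u \<in> pverts G \<Longrightarrow> v \<in> pverts G \<Longrightarrow> (\<phi> u, \<phi> v) \<in> parcs G \<longleftrightarrow> (u, v) \<in> parcs G"
    and col: "\<And>u v. (u, v) \<in> parcs G \<Longrightarrow> col {\<phi> u, \<phi> v} = col {u, v}"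
    using \<phi> by (auto simp: automorphisms_def)
  have inv: "\<phi> (?\<psi> u) = u" "?\<psi> u \<in> pverts G" if "u \<in> pverts G" for u
    using that bij bij_betw_inv_into[OF bij]
    by (auto simp: bij_betw_inv_into_right dest: bij_betwE)
  have arcs': "(?\<psi> u, ?\<psi> v) \<in> parcs G \<longleftrightarrow> (u, v) \<in> parcs G" if "u \<in> pverts G" "v \<in> pverts G" for u v
    using arcs[of "?\<psi> u" "?\<psi> v"] inv that by simp
  have "col {?\<psi> u, ?\<psi> v} = col {u, v}" if "(u, v) \<in> parcs G" for u v
    using col[of "?\<psi> u" "?\<psi> v"] arcs' inv in_arcsD1[OF that] in_arcsD2[OF that] that by simp
  then show ?thesis
    using arcs' bij_betw_inv_into[OF bij] by (simp add: automorphisms_def)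
qed

lemma flag_orbit_self: "u \<in> flag_orbit G col u"
  using automorphisms_id unfolding flag_orbit_def by (metis (mono_tags, lifting) id_apply mem_Collect_eq)

lemma flag_orbit_automorphism:
  assumes \<phi>: "\<phi> \<in> automorphisms G col" and u: "u \<in> pverts G"
  shows "flag_orbit G col (\<phi> u) = flag_orbit G col u"
proof -
  have "inv_into (pverts G) \<phi> (\<phi> u) = u"
    using \<phi> u by (auto simp: automorphisms_def bij_betw_def)
  then have "\<psi> u = (\<psi> \<circ> inv_into (pverts G) \<phi>) (\<phi> u)" for \<psi>
    by simp
  then have "flag_orbit G col u \<subseteq> flag_orbit G col (\<phi> u)"
    unfolding flag_orbit_def
    using automorphisms_comp[OF automorphisms_inv_into[OF \<phi>]] by blast
  moreover have "flag_orbit G col (\<phi> u) \<subseteq> flag_orbit G col u"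
    unfolding flag_orbit_def using automorphisms_comp[OF \<phi>] comp_apply by (smt (verit) Collect_mono_iff)
  ultimately show ?thesis
    by blast
qed

section \<open>Automorphisms acting on components\<close>

lemma reachable_automorphism_image:
  fixes I :: "nat set"
  assumes \<phi>: "\<phi> \<in> automorphisms G col" and u: "u \<in> pverts G"
  shows "\<phi> ` {v. u \<rightarrow>\<^sup>*\<^bsub>with_proj (colour_subgraph G col I)\<^esub> v} =
    {v. \<phi> u \<rightarrow>\<^sup>*\<^bsub>with_proj (colour_subgraph G col I)\<^esub> v}"
proof -
  let ?H = "with_proj (colour_subgraph G col I)"
  interpret H: pair_wf_digraph "colour_subgraph G col I"
    by unfold_locales (auto dest: in_arcsD1 in_arcsD2)
  have img: "\<phi> ` pverts G = pverts G"
    and arcs: "\<And>u v. u \<in> pverts G \<Longrightarrow> v \<in> pverts G \<Longrightarrow> (\<phi> u, \<phi> v) \<in> parcs G \<longleftrightarrow> (u, v) \<in> parcs G"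
    and col: "\<And>u v. (u, v) \<in> parcs G \<Longrightarrow> col {\<phi> u, \<phi> v} = col {u, v}"
    using \<phi> by (auto simp: automorphisms_def bij_betw_def)
  have "\<phi> u \<rightarrow>\<^sup>*\<^bsub>?H\<^esub> \<phi> v" if "u \<rightarrow>\<^sup>*\<^bsub>?H\<^esub> v" for v
    using that
  proof (induction rule: H.reachable_induct)
    case base
    then show ?case using img by auto
  next
    case (step x y)
    then have "(\<phi> x, \<phi> y) \<in> parcs (colour_subgraph G col I)"
      using arcs[of x y] col[of x y] by (auto dest: in_arcsD1 in_arcsD2)
    with step.IH show ?case
      by (rule H.reachable_adj_trans)
  qed
  \<comment> \<open>A path from \<open>\<phi> u\<close> is lifted edge by edge:
    \<open>\<phi>\<close> is onto the flags, and it reflects arcs and their colours.\<close>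
  moreover have "v \<in> \<phi> ` {v. u \<rightarrow>\<^sup>*\<^bsub>?H\<^esub> v}" if "\<phi> u \<rightarrow>\<^sup>*\<^bsub>?H\<^esub> v" for v
    using that
  proof (induction rule: H.reachable_induct)
    case base
    then show ?case using u by auto
  next
    case (step x y)
    then obtain x' where x': "x = \<phi> x'" "u \<rightarrow>\<^sup>*\<^bsub>?H\<^esub> x'"
      by auto
    have xy: "(x, y) \<in> parcs G" "col {x, y} \<in> I"
      using step.hyps by auto
    have "x' \<in> pverts G"
      using x'(2) by (auto dest: H.reachable_in_verts)
    moreover obtain y' where y': "y = \<phi> y'" "y' \<in> pverts G"
      using img in_arcsD2[OF xy(1)] by blast
    ultimately have "(x', y') \<in> parcs (colour_subgraph G col I)"
      using xy arcs[of x' y'] col[of x' y'] x'(1) by auto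
    then have "u \<rightarrow>\<^sup>*\<^bsub>?H\<^esub> y'"
      using x'(2) by (rule H.reachable_adj_trans[rotated])
    with y' show ?case by blast
  qed
  ultimately show ?thesis by blast
qed

text \<open>Faces are induced subgraphs, so with this lemma they can be compared through their flag
  sets alone.\<close>

lemma graph_image_induce_subgraph:
  fixes I :: "nat set"
  assumes \<phi>: "\<phi> \<in> automorphisms G col" and S: "S \<subseteq> pverts G"
  defines "H \<equiv> with_proj (colour_subgraph G col I)"
  shows "graph_image \<phi> (H \<restriction> S) = H \<restriction> (\<phi> ` S)"
proof -
  have arcs: "\<And>u v. u \<in> pverts G \<Longrightarrow> v \<in> pverts G \<Longrightarrow> (\<phi> u, \<phi> v) \<in> parcs G \<longleftrightarrow> (u, v) \<in> parcs G"
    and col: "\<And>u v. (u, v) \<in> parcs G \<Longrightarrow> col {\<phi> u, \<phi> v} = col {u, v}"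
    using \<phi> by (auto simp: automorphisms_def)
  have eq: "(\<phi> u, \<phi> v) \<in> parcs (colour_subgraph G col I)
      \<longleftrightarrow> (u, v) \<in> parcs (colour_subgraph G col I)" if "u \<in> S" "v \<in> S" for u v
  proof -
    have "u \<in> pverts G" "v \<in> pverts G"
      using that S by auto
    then show ?thesis
      using arcs[of u v] col[of u v] by auto
  qed
  have "map_prod \<phi> \<phi> ` arcs (H \<restriction> S) = arcs (H \<restriction> (\<phi> ` S))"
    using eq unfolding H_def by (force simp del: colour_subgraph_simps)
  then show ?thesis
    by (simp add: graph_image_def induce_subgraph_def with_proj_def H_def)
qed

end

section \<open>Neighbouring flags\<close>

context maniplex
begin

definition neighbour :: "nat \<Rightarrow> 'a \<Rightarrow> 'a" where
  "neighbour i u = (THE v. (u, v) \<in> parcs G \<and> col {u, v} = i)"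

abbreviation orbit :: "'a \<Rightarrow> 'a set" where
  "orbit \<equiv> flag_orbit G col"

lemma neighbour:
  assumes "i < n" "u \<in> pverts G"
  shows "(u, neighbour i u) \<in> parcs G" "col {u, neighbour i u} = i" "neighbour i u \<in> pverts G"
proof -
  show *: "(u, neighbour i u) \<in> parcs G" and "col {u, neighbour i u} = i"
    using theI'[OF perfect_matching[OF assms]] by (auto simp: neighbour_def)
  show "neighbour i u \<in> pverts G"
    using * by (rule in_arcsD2)
qed

lemma neighbour_unique:
  assumes "(u, v) \<in> parcs G" "col {u, v} = i"
  shows "neighbour i u = v"
proof -
  have "i < n" "u \<in> pverts G"
    using assms colour_range in_arcsD1 by auto
  then show ?thesis
    using perfect_matching assms neighbour(1,2) by blast
qed

lemma neighbour_neighbour [simp]: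
  assumes "i < n" "u \<in> pverts G"
  shows "neighbour i (neighbour i u) = u"
proof -
  have "(neighbour i u, u) \<in> parcs G" "col {neighbour i u, u} = i"
    using neighbour[OF assms] arcs_symmetric by (auto simp: insert_commute)
  then show ?thesis
    by (rule neighbour_unique)
qed

lemma neighbour_automorphism:
  assumes \<phi>: "\<phi> \<in> automorphisms G col" and "i < n" "u \<in> pverts G"
  shows "neighbour i (\<phi> u) = \<phi> (neighbour i u)"
proof -
  have "(\<phi> u, \<phi> (neighbour i u)) \<in> parcs G" "col {\<phi> u, \<phi> (neighbour i u)} = i"
    using \<phi> assms(3) neighbour[OF assms(2,3)] by (auto simp: automorphisms_def)
  then show ?thesis
    by (rule neighbour_unique)
qed

text \<open>The neighbour map commutes with automorphisms and therefore descends to the set of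
  orbits.\<close>

lemma orbit_neighbour:
  assumes "i < n" "u \<in> pverts G" "v \<in> pverts G" "orbit u = orbit v"
  shows "orbit (neighbour i u) = orbit (neighbour i v)"
proof -
  obtain \<phi> where \<phi>: "\<phi> \<in> automorphisms G col" "v = \<phi> u"
    using flag_orbit_self[of v] assms(4) by (auto simp: flag_orbit_def)
  show ?thesis
    using flag_orbit_automorphism[OF \<phi>(1) neighbour(3)] neighbour_automorphism[OF \<phi>(1)] assms \<phi>(2)
    by simp
qed

lemma pair_sym_digraph_colour_subgraph: "pair_sym_digraph (colour_subgraph G col I)"
proof
  show "symmetric (with_proj (colour_subgraph G col I))"
    using arcs_symmetric by (auto simp: symmetric_def sym_def insert_commute)
qed (auto dest: in_arcsD1 in_arcsD2)

text \<open>The component of \<open>u\<close> in colours \<open>i\<close> and \<open>j\<close> is a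
  4-cycle in which the two neighbours of \<open>u\<close> differ; both sides are the vertex opposite
  to \<open>u\<close>.\<close>

lemma neighbour_commute:
  assumes ij: "i < n" "j < n" "\<bar>int i - int j\<bar> \<ge> 2" and u: "u \<in> pverts G"
  shows "neighbour i (neighbour j u) = neighbour j (neighbour i u)"
proof -
  let ?H = "colour_subgraph G col {i, j}"
  interpret H: pair_sym_digraph ?H
    by (rule pair_sym_digraph_colour_subgraph)
  define S where "S = {v. u \<rightarrow>\<^sup>*\<^bsub>with_proj ?H\<^esub> v}"
  have "with_proj ?H \<restriction> S \<in> components ?H"
    unfolding S_def H.components_conv using u by auto
  then have cycle: "is_four_cycle (with_proj ?H \<restriction> S)"
    by (rule four_cycles[OF ij])
  have uS: "u \<in> S"
    using u by (simp add: S_def)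
  have arc: "(v, neighbour k v) \<in> arcs (with_proj ?H \<restriction> S)" "neighbour k v \<in> S"
    if "k \<in> {i, j}" "v \<in> S" for k v
  proof -
    have v: "v \<in> pverts G"
      using \<open>v \<in> S\<close> H.reachable_in_verts(2) by (auto simp: S_def)
    have e: "(v, neighbour k v) \<in> parcs ?H"
      using neighbour[OF _ v, of k] that ij by auto
    then show "neighbour k v \<in> S"
      using \<open>v \<in> S\<close> H.reachable_adj_trans by (auto simp: S_def)
    with e \<open>v \<in> S\<close> show "(v, neighbour k v) \<in> arcs (with_proj ?H \<restriction> S)"
      by simp
  qed
  have ne: "neighbour k v \<noteq> neighbour l v" if "k < n" "l < n" "k \<noteq> l" "v \<in> pverts G" for k l v
    using that neighbour(2) by metis
  have "i \<noteq> j"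
    using ij by auto
  \<comment> \<open>From \<open>neighbour j u\<close> colour \<open>j\<close> leads back to
    \<open>u\<close>, so colour \<open>i\<close> leads elsewhere; likewise with the colours
    exchanged.\<close>
  have "neighbour i (neighbour j u) \<noteq> u" "neighbour j (neighbour i u) \<noteq> u"
    using ne[of i j "neighbour j u"] ne[of j i "neighbour i u"] neighbour(3)[OF _ u] ij u \<open>i \<noteq> j\<close>
    by auto
  then show ?thesis
    using is_four_cycle_common_neighbour[OF cycle, of u "neighbour j u" "neighbour i u"]
      arc uS ne[of j i u] ij u \<open>i \<noteq> j\<close> by auto
qed

lemma flags_connected_induct:
  assumes u: "u \<in> pverts G" and v: "v \<in> pverts G" and "P u"
    and step: "\<And>w i. w \<in> pverts G \<Longrightarrow> i < n \<Longrightarrow> P w \<Longrightarrow> P (neighbour i w)"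
  shows "P v"
proof -
  have "strongly_connected (with_proj G)"
    using connected_flag_graph by (rule symmetric_connected_imp_strongly_connected[OF sym_arcs])
  then have "u \<rightarrow>\<^sup>*\<^bsub>with_proj G\<^esub> v"
    using u v by (auto simp: strongly_connected_def)
  then show ?thesis
  proof (induction rule: reachable_induct)
    case base
    show ?case by fact
  next
    case (step x y)
    then have "(x, y) \<in> parcs G"
      by simp
    then show ?case
      using assms(4)[OF in_arcsD1 colour_range step.IH] neighbour_unique[OF _ refl] by metis
  qed
qed

section \<open>Cuts of the flag graph\<close>

text \<open>This is the set called \<open>A\<^sub>j\<close> in the overview, detached from the face
  that produced it. The last clause records properness as an edge of colour \<open>j\<close> that
  leaves or enters the set.\<close>

definition cut :: "nat \<Rightarrow> 'a set \<Rightarrow> bool" where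
  "cut j A \<longleftrightarrow>
     (\<forall>u\<in>pverts G. \<forall>v\<in>pverts G. orbit u = orbit v \<longrightarrow> (u \<in> A \<longleftrightarrow> v \<in> A)) \<and>
     (\<forall>u\<in>pverts G. \<forall>i<n. i \<noteq> j \<longrightarrow> (neighbour i u \<in> A \<longleftrightarrow> u \<in> A)) \<and>
     (\<exists>u\<in>pverts G. (neighbour j u \<in> A) \<noteq> (u \<in> A))"

text \<open>Take faces through \<open>u\<close> and \<open>u'\<close> such that no automorphism maps
  the second to the first. The flags with an image in the face of \<open>u\<close> include
  \<open>u\<close> but not \<open>u'\<close>.\<close>

lemma not_face_transitive_imp_cut:
  assumes j: "j < n" and "\<not> face_transitive G col j"
  obtains A where "cut j A"
proof -
  let ?H = "colour_subgraph G col (- {j})"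
  interpret H: pair_sym_digraph ?H
    by (rule pair_sym_digraph_colour_subgraph)
  define S where "S = (\<lambda>u. {v. u \<rightarrow>\<^sup>*\<^bsub>with_proj ?H\<^esub> v})"
  have S_self: "w \<in> S w" if "w \<in> pverts G" for w
    using that by (simp add: S_def)
  have S_subset: "S w \<subseteq> pverts G" for w
    using H.reachable_in_verts(2) by (auto simp: S_def)
  have S_eq: "S v = S w" if "v \<in> S w" for v w
    using that by (auto simp: S_def intro: H.reachable_trans H.symmetric_reachable')
  obtain u u' where u: "u \<in> pverts G" "u' \<in> pverts G"
    and no: "\<And>\<phi>. \<phi> \<in> automorphisms G col \<Longrightarrow>
      graph_image \<phi> (with_proj ?H \<restriction> S u') \<noteq> with_proj ?H \<restriction> S u"
    using assms(2) unfolding face_transitive_def faces_def H.components_conv S_def by auto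
  define A where "A = {w \<in> pverts G. orbit w \<inter> S u \<noteq> {}}"
  have "u \<in> A"
    using u(1) S_self flag_orbit_self by (auto simp: A_def)
  have "u' \<notin> A"
  proof
    assume "u' \<in> A"
    then obtain \<phi> where \<phi>: "\<phi> \<in> automorphisms G col" "\<phi> u' \<in> S u"
      by (auto simp: A_def flag_orbit_def)
    \<comment> \<open>An automorphism maps components onto components, so one that sends a single
      flag of a face into \<open>S u\<close> sends the whole face onto it.\<close>
    have "\<phi> ` S u' = S u"
      using reachable_automorphism_image[OF \<phi>(1) u(2)] S_eq[OF \<phi>(2)] by (simp add: S_def)
    then show False
      using no[OF \<phi>(1)] graph_image_induce_subgraph[OF \<phi>(1) S_subset] by simp
  qed
  have closed: "neighbour i w \<in> A" if w: "w \<in> A" and i: "i < n" "i \<noteq> j" for i w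
  proof -
    obtain \<phi> where \<phi>: "\<phi> \<in> automorphisms G col" "\<phi> w \<in> S u" and "w \<in> pverts G"
      using w by (auto simp: A_def flag_orbit_def)
    have "\<phi> w \<in> pverts G"
      using \<phi>(2) S_subset by blast
    then have "(\<phi> w, neighbour i (\<phi> w)) \<in> parcs ?H"
      using neighbour[of i "\<phi> w"] i by auto
    then have "neighbour i (\<phi> w) \<in> S u"
      using \<phi>(2) H.reachable_adj_trans by (auto simp: S_def)
    then have "\<phi> (neighbour i w) \<in> S u"
      using neighbour_automorphism[OF \<phi>(1) i(1) \<open>w \<in> pverts G\<close>] by simp
    moreover have "\<phi> (neighbour i w) \<in> orbit (neighbour i w)"
      using \<phi>(1) by (auto simp: flag_orbit_def)
    ultimately show ?thesis
      using neighbour(3)[OF i(1) \<open>w \<in> pverts G\<close>] by (auto simp: A_def)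
  qed
  \<comment> \<open>The converse direction applies \<open>closed\<close> to the neighbour, the map
    being an involution.\<close>
  have inv: "neighbour i w \<in> A \<longleftrightarrow> w \<in> A" if "w \<in> pverts G" "i < n" "i \<noteq> j" for i w
    using closed[of w i] closed[of "neighbour i w" i] that by auto
  \<comment> \<open>Otherwise every colour would preserve \<open>A\<close>, and connectivity would
    carry membership from \<open>u\<close> to \<open>u'\<close>.\<close>
  have "\<exists>w\<in>pverts G. (neighbour j w \<in> A) \<noteq> (w \<in> A)"
  proof (rule ccontr)
    assume "\<not> ?thesis"
    then have "neighbour i w \<in> A \<longleftrightarrow> w \<in> A" if "w \<in> pverts G" "i < n" for i w
      using inv that by (cases "i = j") auto
    then have "u' \<in> A"
      using flags_connected_induct[of u u' "\<lambda>w. w \<in> A"] u \<open>u \<in> A\<close> by blast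
    with \<open>u' \<notin> A\<close> show False ..
  qed
  then have "cut j A"
    using inv by (auto simp: cut_def A_def)
  then show thesis
    by (rule that)
qed

lemma cut_orbit:
  "\<lbrakk>cut j A; u \<in> pverts G; v \<in> pverts G; orbit u = orbit v\<rbrakk> \<Longrightarrow> u \<in> A \<longleftrightarrow> v \<in> A"
  unfolding cut_def by metis

lemma cut_separates:
  "\<lbrakk>cut j A; u \<in> pverts G; v \<in> pverts G; (u \<in> A) \<noteq> (v \<in> A)\<rbrakk> \<Longrightarrow> orbit u \<noteq> orbit v"
  unfolding cut_def by metis

lemma cut_neighbour:
  "\<lbrakk>cut j A; u \<in> pverts G; i < n; i \<noteq> j\<rbrakk> \<Longrightarrow> neighbour i u \<in> A \<longleftrightarrow> u \<in> A"
  unfolding cut_def by metis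

text \<open>Being moved across the cut is a property of the orbit, because both membership in
  \<open>A\<close> and the neighbour map respect orbits.\<close>

lemma cut_crossing_orbit:
  assumes "cut j A" "j < n" "u \<in> pverts G" "v \<in> pverts G" "orbit u = orbit v"
  shows "(neighbour j u \<in> A \<longleftrightarrow> u \<in> A) \<longleftrightarrow> (neighbour j v \<in> A \<longleftrightarrow> v \<in> A)"
  using cut_orbit[OF assms(1,3-5)]
    cut_orbit[OF assms(1) neighbour(3)[OF assms(2,3)] neighbour(3)[OF assms(2,4)]
      orbit_neighbour[OF assms(2-5)]]
  by (simp only:)

section \<open>Counting orbits with several cuts\<close>

lemma four_orbits_cover:
  assumes "card (flag_orbits G col) = 4"
    and "distinct [orbit p, orbit q, orbit r, orbit s]"
    and "p \<in> pverts G" "q \<in> pverts G" "r \<in> pverts G" "s \<in> pverts G" "v \<in> pverts G"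
  shows "orbit v \<in> {orbit p, orbit q, orbit r, orbit s}"
proof -
  \<comment> \<open>An infinite set has \<open>card\<close> 0, so the value 4 forces
    finiteness.\<close>
  have "finite (flag_orbits G col)"
    using assms(1) by (metis card.infinite zero_neq_numeral)
  moreover have "{orbit p, orbit q, orbit r, orbit s} \<subseteq> flag_orbits G col"
    using assms(3-) by (auto simp: flag_orbits_conv)
  moreover have "card {orbit p, orbit q, orbit r, orbit s} = card (flag_orbits G col)"
    using assms(1,2) by simp
  ultimately have "{orbit p, orbit q, orbit r, orbit s} = flag_orbits G col"
    by (rule card_subset_eq)
  then show ?thesis
    using assms(7) by (auto simp: flag_orbits_conv)
qed

lemma commuting_cuts_not_both_crossed:
  assumes four: "card (flag_orbits G col) = 4"
    and cuts: "cut a A" "cut b B" "cut c C"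
    and cols: "a < n" "b < n" "c < n" "c \<noteq> a" "c \<noteq> b" "\<bar>int a - int b\<bar> \<ge> 2"
    and q: "q \<in> pverts G" "(neighbour a q \<in> A) \<noteq> (q \<in> A)"
  shows "neighbour b q \<in> B \<longleftrightarrow> q \<in> B"
proof (rule ccontr)
  assume qB: "\<not> ?thesis"
  let ?p = "neighbour a q" and ?r = "neighbour b q" and ?s = "neighbour a (neighbour b q)"
  have flags: "?p \<in> pverts G" "?r \<in> pverts G" "?s \<in> pverts G"
    using neighbour(3) cols q(1) by auto
  have ab: "a \<noteq> b"
    using cols by auto
  \<comment> \<open>Commutation reaches \<open>?s\<close> from \<open>?p\<close> by colour
    \<open>b\<close>, which does not cross \<open>A\<close>. Thus \<open>A\<close> splits
    \<open>q\<close>, \<open>?r\<close> from \<open>?p\<close>, \<open>?s\<close>, while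
    \<open>B\<close> splits \<open>q\<close>, \<open>?p\<close> from \<open>?r\<close>,
    \<open>?s\<close>.\<close>
  have s: "?s = neighbour b ?p"
    using neighbour_commute cols q(1) by auto
  have A: "?r \<in> A \<longleftrightarrow> q \<in> A" "?s \<in> A \<longleftrightarrow> ?p \<in> A"
    using cut_neighbour[OF cuts(1)] ab cols q(1) flags s by auto
  have B: "?p \<in> B \<longleftrightarrow> q \<in> B" "?s \<in> B \<longleftrightarrow> ?r \<in> B"
    using cut_neighbour[OF cuts(2)] ab cols q(1) flags by auto
  have C: "?p \<in> C \<longleftrightarrow> q \<in> C" "?r \<in> C \<longleftrightarrow> q \<in> C" "?s \<in> C \<longleftrightarrow> q \<in> C"
    using cut_neighbour[OF cuts(3)] cols q(1) flags by auto
  have "orbit q \<noteq> orbit ?p" "orbit q \<noteq> orbit ?s" "orbit ?p \<noteq> orbit ?r" "orbit ?r \<noteq> orbit ?s"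
    using A q flags by (intro cut_separates[OF cuts(1)]; simp)+
  moreover have "orbit q \<noteq> orbit ?r" "orbit ?p \<noteq> orbit ?s"
    using B q qB flags by (intro cut_separates[OF cuts(2)]; simp)+
  ultimately have dist: "distinct [orbit q, orbit ?p, orbit ?r, orbit ?s]"
    by simp
  \<comment> \<open>Every flag shares its orbit with one of the four, and these are joined by
    colours other than \<open>c\<close>; so \<open>C\<close> contains all flags or none.\<close>
  have "w \<in> C \<longleftrightarrow> q \<in> C" if w: "w \<in> pverts G" for w
    using four_orbits_cover[OF four dist q(1) flags w] C cut_orbit[OF cuts(3) w q(1)]
      cut_orbit[OF cuts(3) w flags(1)] cut_orbit[OF cuts(3) w flags(2)]
      cut_orbit[OF cuts(3) w flags(3)] by auto
  then have "neighbour c w \<in> C \<longleftrightarrow> w \<in> C" if "w \<in> pverts G" for w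
    using that neighbour(3) cols by simp
  then show False
    using cuts(3) unfolding cut_def by metis
qed

lemma no_cut_commutes_with_two_others:
  assumes four: "card (flag_orbits G col) = 4"
    and cuts: "cut x X" "cut y Y" "cut z Z"
    and cols: "x < n" "y < n" "z < n" "y \<noteq> z"
    and comm: "\<bar>int x - int y\<bar> \<ge> 2" "\<bar>int x - int z\<bar> \<ge> 2"
  shows False
proof -
  have ne: "x \<noteq> y" "x \<noteq> z"
    using comm by auto
  obtain p u v where p: "p \<in> pverts G" "(neighbour x p \<in> X) \<noteq> (p \<in> X)"
    and u: "u \<in> pverts G" "(neighbour y u \<in> Y) \<noteq> (u \<in> Y)"
    and v: "v \<in> pverts G" "(neighbour z v \<in> Z) \<noteq> (v \<in> Z)"
    using cuts unfolding cut_def by metis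
  let ?p = "neighbour x p" and ?u = "neighbour y u" and ?v = "neighbour z v"
  have flags: "?p \<in> pverts G" "?u \<in> pverts G" "?v \<in> pverts G"
    using neighbour(3) cols p u v by auto
  have cross: "(neighbour x ?p \<in> X) \<noteq> (?p \<in> X)" "(neighbour y ?u \<in> Y) \<noteq> (?u \<in> Y)"
    "(neighbour z ?v \<in> Z) \<noteq> (?v \<in> Z)"
    using p u v cols by auto
  \<comment> \<open>If the orbits agreed, \<open>s\<close> would also be moved across
    \<open>Y\<close>, hence across the cuts of two commuting colours, with \<open>z\<close> as the
    third colour.\<close>
  have XY: "orbit s \<noteq> orbit t" if "s \<in> pverts G" "t \<in> pverts G"
    "(neighbour x s \<in> X) \<noteq> (s \<in> X)" "(neighbour y t \<in> Y) \<noteq> (t \<in> Y)" for s t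
  proof
    assume "orbit s = orbit t"
    then have "(neighbour y s \<in> Y) \<noteq> (s \<in> Y)"
      using cut_crossing_orbit[OF cuts(2) _ that(1,2)] cols that(4) by simp
    then show False
      using commuting_cuts_not_both_crossed[OF four cuts(1,2,3) _ _ _ _ _ _ that(1,3)] cols ne comm
      by simp
  qed
  have XZ: "orbit s \<noteq> orbit t" if "s \<in> pverts G" "t \<in> pverts G"
    "(neighbour x s \<in> X) \<noteq> (s \<in> X)" "(neighbour z t \<in> Z) \<noteq> (t \<in> Z)" for s t
  proof
    assume "orbit s = orbit t"
    then have "(neighbour z s \<in> Z) \<noteq> (s \<in> Z)"
      using cut_crossing_orbit[OF cuts(3) _ that(1,2)] cols that(4) by simp
    then show False
      using commuting_cuts_not_both_crossed[OF four cuts(1,3,2) _ _ _ _ _ _ that(1,3)] cols ne comm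
      by simp
  qed
  have "orbit p \<noteq> orbit ?p" "orbit u \<noteq> orbit ?u" and vv: "orbit v \<noteq> orbit ?v"
    using cut_separates[OF cuts(1) p(1) flags(1)] cut_separates[OF cuts(2) u(1) flags(2)]
      cut_separates[OF cuts(3) v(1) flags(3)] p(2) u(2) v(2) by simp_all
  then have dist: "distinct [orbit p, orbit ?p, orbit u, orbit ?u]"
    using XY[OF p(1) u(1) p(2) u(2)] XY[OF p(1) flags(2) p(2) cross(2)]
      XY[OF flags(1) u(1) cross(1) u(2)] XY[OF flags(1,2) cross(1,2)] by simp
  note cover = four_orbits_cover[OF four dist p(1) flags(1) u(1) flags(2)]
  have "orbit v \<in> {orbit u, orbit ?u}" "orbit ?v \<in> {orbit u, orbit ?u}"
    using cover[OF v(1)] cover[OF flags(3)] XZ[OF p(1) v(1) p(2) v(2)]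
      XZ[OF p(1) flags(3) p(2) cross(3)] XZ[OF flags(1) v(1) cross(1) v(2)]
      XZ[OF flags(1,3) cross(1,3)] by auto
  with vv have "orbit v = orbit u \<and> orbit ?v = orbit ?u \<or> orbit v = orbit ?u \<and> orbit ?v = orbit u"
    by auto
  \<comment> \<open>The flags \<open>v\<close> and \<open>?v\<close> occupy the orbits of
    \<open>u\<close> and \<open>?u\<close>, one each, and these lie on opposite sides of
    \<open>Y\<close>. Yet colour \<open>z\<close> preserves \<open>Y\<close>.\<close>
  then have "(v \<in> Y) \<noteq> (?v \<in> Y)"
    using u(2) cut_orbit[OF cuts(2) v(1) u(1)] cut_orbit[OF cuts(2) v(1) flags(2)]
      cut_orbit[OF cuts(2) flags(3) u(1)] cut_orbit[OF cuts(2) flags(3,2)] by auto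
  then show False
    using cut_neighbour[OF cuts(2) v(1)] cols by simp
qed

section \<open>Positions of the failing colours\<close>

lemma not_face_transitive_consecutive:
  assumes "card (flag_orbits G col) = 4"
    and "\<not> face_transitive G col x" "\<not> face_transitive G col y" "\<not> face_transitive G col z"
    and "x < n" "y < n" "z < n" "y \<noteq> z"
  shows "\<bar>int x - int y\<bar> < 2 \<or> \<bar>int x - int z\<bar> < 2"
  using assms no_cut_commutes_with_two_others not_face_transitive_imp_cut by (metis not_less)

end

theorem theorem4p7:
  fixes n :: nat and G :: "'a pair_pre_digraph" and col :: "'a set \<Rightarrow> nat"
  assumes "maniplex n G col"
    and "card (flag_orbits G col) = 4"
  shows "fully_transitive n G col
    \<or> (\<exists>i<n. \<forall>j<n. j \<noteq> i \<longrightarrow> face_transitive G col j)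
    \<or> (\<exists>i<n. \<exists>k<n. i \<noteq> k \<and> (\<forall>j<n. j \<noteq> i \<and> j \<noteq> k \<longrightarrow> face_transitive G col j))
    \<or> (\<exists>i<n. \<forall>j<n. int j \<notin> {int i - 1, int i, int i + 1} \<longrightarrow> face_transitive G col j)"
proof (rule ccontr)
  assume neg: "\<not> ?thesis"
  interpret maniplex n G col by fact
  let ?bad = "\<lambda>j. j < n \<and> \<not> face_transitive G col j"
  \<comment> \<open>Refuting the first three alternatives in turn supplies three distinct failing
    colours.\<close>
  obtain a' where "?bad a'"
    using neg by (auto simp: fully_transitive_def)
  moreover obtain b' where "?bad b'" "b' \<noteq> a'"
    using neg calculation by blast
  moreover obtain c' where "?bad c'" "c' \<noteq> a'" "c' \<noteq> b'"
    using neg calculation by metis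
  ultimately obtain a b c where bad: "?bad a" "?bad b" "?bad c" and less: "a < b" "b < c"
    by (metis nat_neq_iff)
  \<comment> \<open>The fourth alternative is refuted at the middle colour \<open>b\<close>, so
    \<open>d\<close> differs from \<open>b\<close> by at least 2. It is still farther from
    \<open>c\<close> if it lies below \<open>b\<close>, and from \<open>a\<close> if above; either
    way it commutes with two failing colours.\<close>
  obtain d where d: "?bad d" "int d \<notin> {int b - 1, int b, int b + 1}"
    using neg bad(2) by blast
  show False
  proof (cases "d < b")
    case True
    then show False
      using not_face_transitive_consecutive[OF assms(2), of d b c] bad d less by auto
  next
    case False
    then show False
      using not_face_transitive_consecutive[OF assms(2), of d b a] bad d less by auto
  qed
qed

end
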